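(* $\mathsf{RTC}^{\omega}_{G}$ is complete for the standard semantics: every sequent $\Gamma\Rightarrow\Delta$ of $\mathcal{L}_{\mathsf{RTC}}$ that is valid with respect to the standard semantics has an $\mathsf{RTC}^{\omega}_{G}$ proof.
   Context: Fix a (countable) first-order signature with equality. Formulas of $\mathcal{L}_{\mathsf{RTC}}$: first-order formulas (with $=,\neg,\wedge,\vee,\to,\forall,\exists$) extended by $(RTC_{x,y}\,\varphi)(s,t)$ for distinct variables $x,y$ bound in $\varphi$ and terms $s,t$. Standard semantics: usual, and $M,v\models (RTC_{x,y}\varphi)(s,t)$ iff $v(s)=v(t)$, or there are $a_0,\dots,a_n$ in the domain ($n>0$) with $a_0=v(s)$, $a_n=v(t)$ and $M,v[x:=a_i,y:=a_{i+1}]\models\varphi$ for $0\le i<n$. A sequent $\Gamma\Rightarrow\Delta$ (finite sets) is valid if every $M,v$ satisfying all of $\Gamma$ satisfies some formula of $\Delta$. $\mathsf{RTC}^{\omega}_{G}$ consists of: the classical sequent calculus $\mathcal{LK}_=$ (axiom $\varphi\Rightarrow\varphi$, weakening, usual left/right rules for connectives and quantifiers with eigenvariable conditions, $(=L_1)$: from $\Gamma\Rightarrow\varphi[s/x],\Delta$ infer $\Gamma,s=t\Rightarrow\varphi[t/x],\Delta$, $(=L_2)$: from $\Gamma\Rightarrow\varphi[t/x],\Delta$ infer $\Gamma,s=t\Rightarrow\varphi[s/x],\Delta$, $(=R)$: $\Rightarrow t=t$, Cut, and (Subst): from $\Gamma\Rightarrow\Delta$ infer $\Gamma\theta\Rightarrow\Delta\theta$);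 (Refl) $\Gamma\Rightarrow\Delta,(RTC_{x,y}\varphi)(s,s)$; (Trans) from $\Gamma\Rightarrow\Delta,(RTC_{x,y}\varphi)(s,r)$ and $\Gamma\Rightarrow\Delta,\varphi[r/x,t/y]$ infer $\Gamma\Rightarrow\Delta,(RTC_{x,y}\varphi)(s,t)$; (Case) from $\Gamma,s=t\Rightarrow\Delta$ and $\Gamma,(RTC_{x,y}\varphi)(s,z),\varphi[z/x,t/y]\Rightarrow\Delta$ infer $\Gamma,(RTC_{x,y}\varphi)(s,t)\Rightarrow\Delta$, $z$ fresh; $(RTC_{x,y}\varphi)(s,z)$ is the immediate ancestor of the principal formula. A pre-proof is a possibly infinite derivation tree with no open leaves. For $RTC$-formulas $\tau,\tau'$ in the antecedents of the conclusion $S$ and a premise $S'$ of a rule instance, $(\tau,\tau')$ is a trace pair if: the rule is (Subst) with substitution $\theta$ and $\tau=\tau'\theta$; or the rule is (Case) and either $\tau$ is principal and $\tau'$ its immediate ancestor (progressing), or $\tau=\tau'$; or otherwise $\tau=\tau'$. A trace $\tau_1,\tau_2,\dots$ follows a path $S_1,S_2,\dots$ (from the root through premises) if for some $k\ge0$ each $(\tau_i,\tau_{i+1})$ is a trace pair for $(S_{i+k},S_{i+k+1})$; it is infinitely progressing if infinitely many pairs are progressing. An $\mathsf{RTC}^{\omega}_{G}$ proof is a pre-proof every infinite path of which is followed by an infinitely progressing trace. *)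

theory Defs
  imports "HOL-Library.Countable_Set" "HOL-Library.Infinite_Set"
begin

text \<open>
  Binding is represented by de Bruijn indices, so that formulas are identified up to renaming of
  bound variables and substitution is capture-avoiding.  Outside all binders, the free variables
  are the variables \<open>Var 0, Var 1, \<dots>\<close>.
\<close>

datatype 'f tm = Var nat | Fn 'f "'f tm list"

text \<open>
  \<open>RTC \<phi> s t\<close> stands for \<open>(RTC\<^sub>x\<^sub>,\<^sub>y \<phi>)(s,t)\<close>.  It binds two variables in \<open>\<phi>\<close>: index \<open>0\<close> is \<open>x\<close> and
  index \<open>1\<close> is \<open>y\<close>; nothing is bound in \<open>s\<close> and \<open>t\<close>.
\<close>

datatype ('f, 'p) fm =
    Pred 'p "'f tm list"
  | Eq "'f tm" "'f tm"
  | Neg "('f, 'p) fm"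
  | Conj "('f, 'p) fm" "('f, 'p) fm"
  | Disj "('f, 'p) fm" "('f, 'p) fm"
  | Imp "('f, 'p) fm" "('f, 'p) fm"
  | Forall "('f, 'p) fm"
  | Exists "('f, 'p) fm"
  | is_RTC: RTC "('f, 'p) fm" "'f tm" "'f tm"

text \<open>
  The symbols of a signature are those with a defined arity; either kind of symbol may be absent.
\<close>

record ('f, 'p) signature =
  fun_arity :: "'f \<Rightarrow> nat option"
  pred_arity :: "'p \<Rightarrow> nat option"

definition countable_signature :: "('f, 'p) signature \<Rightarrow> bool" where
  "countable_signature L \<longleftrightarrow> countable (dom (fun_arity L)) \<and> countable (dom (pred_arity L))"

fun wf_tm :: "('f, 'p) signature \<Rightarrow> 'f tm \<Rightarrow> bool" where
  "wf_tm L (Var n) \<longleftrightarrow> True"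
| "wf_tm L (Fn f ts) \<longleftrightarrow> fun_arity L f = Some (length ts) \<and> (\<forall>t\<in>set ts. wf_tm L t)"

primrec wf_fm :: "('f, 'p) signature \<Rightarrow> ('f, 'p) fm \<Rightarrow> bool" where
  "wf_fm L (Pred p ts) \<longleftrightarrow> pred_arity L p = Some (length ts) \<and> (\<forall>t\<in>set ts. wf_tm L t)"
| "wf_fm L (Eq s t) \<longleftrightarrow> wf_tm L s \<and> wf_tm L t"
| "wf_fm L (Neg \<phi>) \<longleftrightarrow> wf_fm L \<phi>"
| "wf_fm L (Conj \<phi> \<psi>) \<longleftrightarrow> wf_fm L \<phi> \<and> wf_fm L \<psi>"
| "wf_fm L (Disj \<phi> \<psi>) \<longleftrightarrow> wf_fm L \<phi> \<and> wf_fm L \<psi>"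
| "wf_fm L (Imp \<phi> \<psi>) \<longleftrightarrow> wf_fm L \<phi> \<and> wf_fm L \<psi>"
| "wf_fm L (Forall \<phi>) \<longleftrightarrow> wf_fm L \<phi>"
| "wf_fm L (Exists \<phi>) \<longleftrightarrow> wf_fm L \<phi>"
| "wf_fm L (RTC \<phi> s t) \<longleftrightarrow> wf_fm L \<phi> \<and> wf_tm L s \<and> wf_tm L t"

primrec fv_tm :: "'f tm \<Rightarrow> nat set" where
  "fv_tm (Var n) = {n}"
| "fv_tm (Fn f ts) = \<Union> (set (map fv_tm ts))"

primrec fv :: "('f, 'p) fm \<Rightarrow> nat set" where
  "fv (Pred p ts) = \<Union> (set (map fv_tm ts))"
| "fv (Eq s t) = fv_tm s \<union> fv_tm t"
| "fv (Neg \<phi>) = fv \<phi>"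
| "fv (Conj \<phi> \<psi>) = fv \<phi> \<union> fv \<psi>"
| "fv (Disj \<phi> \<psi>) = fv \<phi> \<union> fv \<psi>"
| "fv (Imp \<phi> \<psi>) = fv \<phi> \<union> fv \<psi>"
| "fv (Forall \<phi>) = {n. Suc n \<in> fv \<phi>}"
| "fv (Exists \<phi>) = {n. Suc n \<in> fv \<phi>}"
| "fv (RTC \<phi> s t) = {n. Suc (Suc n) \<in> fv \<phi>} \<union> fv_tm s \<union> fv_tm t"

primrec subst_tm :: "(nat \<Rightarrow> 'f tm) \<Rightarrow> 'f tm \<Rightarrow> 'f tm" where
  "subst_tm \<theta> (Var n) = \<theta> n"
| "subst_tm \<theta> (Fn f ts) = Fn f (map (subst_tm \<theta>) ts)"

definition lift_subst :: "(nat \<Rightarrow> 'f tm) \<Rightarrow> nat \<Rightarrow> 'f tm" where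
  "lift_subst \<theta> = case_nat (Var 0) (\<lambda>n. subst_tm (\<lambda>m. Var (Suc m)) (\<theta> n))"

primrec subst :: "(nat \<Rightarrow> 'f tm) \<Rightarrow> ('f, 'p) fm \<Rightarrow> ('f, 'p) fm" where
  "subst \<theta> (Pred p ts) = Pred p (map (subst_tm \<theta>) ts)"
| "subst \<theta> (Eq s t) = Eq (subst_tm \<theta> s) (subst_tm \<theta> t)"
| "subst \<theta> (Neg \<phi>) = Neg (subst \<theta> \<phi>)"
| "subst \<theta> (Conj \<phi> \<psi>) = Conj (subst \<theta> \<phi>) (subst \<theta> \<psi>)"
| "subst \<theta> (Disj \<phi> \<psi>) = Disj (subst \<theta> \<phi>) (subst \<theta> \<psi>)"
| "subst \<theta> (Imp \<phi> \<psi>) = Imp (subst \<theta> \<phi>) (subst \<theta> \<psi>)"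
| "subst \<theta> (Forall \<phi>) = Forall (subst (lift_subst \<theta>) \<phi>)"
| "subst \<theta> (Exists \<phi>) = Exists (subst (lift_subst \<theta>) \<phi>)"
| "subst \<theta> (RTC \<phi> s t) =
     RTC (subst (lift_subst (lift_subst \<theta>)) \<phi>) (subst_tm \<theta> s) (subst_tm \<theta> t)"

text \<open>
  \<open>inst \<phi> t\<close> is \<open>\<phi>[t/x]\<close> for the body \<open>\<phi>\<close> of a quantifier, and \<open>inst2 \<phi> s t\<close> is the simultaneous
  substitution \<open>\<phi>[s/x,t/y]\<close> for the body \<open>\<phi>\<close> of an \<open>RTC\<close>-formula; the remaining indices are those
  of the surrounding context.
\<close>

definition inst :: "('f, 'p) fm \<Rightarrow> 'f tm \<Rightarrow> ('f, 'p) fm" where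
  "inst \<phi> t = subst (case_nat t Var) \<phi>"

definition inst2 :: "('f, 'p) fm \<Rightarrow> 'f tm \<Rightarrow> 'f tm \<Rightarrow> ('f, 'p) fm" where
  "inst2 \<phi> s t = subst (case_nat s (case_nat t Var)) \<phi>"

record ('f, 'p, 'u) struct =
  domain :: "'u set"
  fun_interp :: "'f \<Rightarrow> 'u list \<Rightarrow> 'u"
  pred_interp :: "'p \<Rightarrow> 'u list \<Rightarrow> bool"

definition is_struct :: "('f, 'p) signature \<Rightarrow> ('f, 'p, 'u) struct \<Rightarrow> bool" where
  "is_struct L M \<longleftrightarrow> domain M \<noteq> {} \<and>
     (\<forall>f us. fun_arity L f = Some (length us) \<and> set us \<subseteq> domain M \<longrightarrow>
        fun_interp M f us \<in> domain M)"

primrec val :: "('f, 'p, 'u) struct \<Rightarrow> (nat \<Rightarrow> 'u) \<Rightarrow> 'f tm \<Rightarrow> 'u" where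
  "val M v (Var n) = v n"
| "val M v (Fn f ts) = fun_interp M f (map (val M v) ts)"

primrec sat :: "('f, 'p, 'u) struct \<Rightarrow> (nat \<Rightarrow> 'u) \<Rightarrow> ('f, 'p) fm \<Rightarrow> bool" where
  "sat M v (Pred p ts) \<longleftrightarrow> pred_interp M p (map (val M v) ts)"
| "sat M v (Eq s t) \<longleftrightarrow> val M v s = val M v t"
| "sat M v (Neg \<phi>) \<longleftrightarrow> \<not> sat M v \<phi>"
| "sat M v (Conj \<phi> \<psi>) \<longleftrightarrow> sat M v \<phi> \<and> sat M v \<psi>"
| "sat M v (Disj \<phi> \<psi>) \<longleftrightarrow> sat M v \<phi> \<or> sat M v \<psi>"
| "sat M v (Imp \<phi> \<psi>) \<longleftrightarrow> (sat M v \<phi> \<longrightarrow> sat M v \<psi>)"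
| "sat M v (Forall \<phi>) \<longleftrightarrow> (\<forall>a\<in>domain M. sat M (case_nat a v) \<phi>)"
| "sat M v (Exists \<phi>) \<longleftrightarrow> (\<exists>a\<in>domain M. sat M (case_nat a v) \<phi>)"
| "sat M v (RTC \<phi> s t) \<longleftrightarrow> val M v s = val M v t \<or>
     (\<exists>n>0. \<exists>a. (\<forall>i\<le>n. a i \<in> domain M) \<and> a 0 = val M v s \<and> a n = val M v t \<and>
        (\<forall>i<n. sat M (case_nat (a i) (case_nat (a (Suc i)) v)) \<phi>))"

datatype ('f, 'p) sequent =
  Sequent (ante: "('f, 'p) fm set") (succ: "('f, 'p) fm set") (infix \<open>\<turnstile>\<close> 50)

definition wf_sequent :: "('f, 'p) signature \<Rightarrow> ('f, 'p) sequent \<Rightarrow> bool" where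
  "wf_sequent L S \<longleftrightarrow> finite (ante S) \<and> finite (succ S) \<and> (\<forall>\<phi>\<in>ante S \<union> succ S. wf_fm L \<phi>)"

text \<open>
  HOL cannot quantify over all types, so validity refers to the structures whose domain is an
  arbitrary nonempty subset of a given type \<open>'u\<close>.  Up to isomorphism these are all structures of
  cardinality at most that of \<open>'u\<close>, so validity for one type is implied by validity in general.
\<close>

definition valid :: "'u itself \<Rightarrow> ('f, 'p) signature \<Rightarrow> ('f, 'p) sequent \<Rightarrow> bool" where
  "valid U L S \<longleftrightarrow>
     (\<forall>(M :: ('f, 'p, 'u) struct) v. is_struct L M \<and> range v \<subseteq> domain M \<longrightarrow>
        (\<forall>\<phi>\<in>ante S. sat M v \<phi>) \<longrightarrow> (\<exists>\<psi>\<in>succ S. sat M v \<psi>))"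

abbreviation fvs :: "('f, 'p) fm set \<Rightarrow> nat set" where
  "fvs \<Gamma> \<equiv> \<Union> (fv ` \<Gamma>)"

text \<open>
  A rule instance is labelled with the data on which its trace pairs depend:
  the substitution of (Subst), and the principal formula \<open>RTC \<phi> s t\<close> together with the fresh
  variable \<open>z\<close> of (Case).  All other rules carry the label \<open>Plain\<close>.
\<close>

datatype ('f, 'p) label =
    Plain
  | SubstBy "nat \<Rightarrow> 'f tm"
  | CaseOn "('f, 'p) fm" "'f tm" "'f tm" nat

text \<open>
  \<open>infer r Ss S\<close>: the sequent \<open>S\<close> follows from the list \<open>Ss\<close> of premises by one rule labelled \<open>r\<close>.
  As sequents consist of sets, a principal formula may also occur in the context, which gives
  contraction.
\<close>

inductive infer :: "('f, 'p) label \<Rightarrow> ('f, 'p) sequent list \<Rightarrow> ('f, 'p) sequent \<Rightarrow> bool" where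
  Ax: "infer Plain [] ({\<phi>} \<turnstile> {\<phi>})"
| WeakL: "infer Plain [\<Gamma> \<turnstile> \<Delta>] (insert \<phi> \<Gamma> \<turnstile> \<Delta>)"
| WeakR: "infer Plain [\<Gamma> \<turnstile> \<Delta>] (\<Gamma> \<turnstile> insert \<phi> \<Delta>)"
| NegL: "infer Plain [\<Gamma> \<turnstile> insert \<phi> \<Delta>] (insert (Neg \<phi>) \<Gamma> \<turnstile> \<Delta>)"
| NegR: "infer Plain [insert \<phi> \<Gamma> \<turnstile> \<Delta>] (\<Gamma> \<turnstile> insert (Neg \<phi>) \<Delta>)"
| ConjL: "infer Plain [insert \<phi> (insert \<psi> \<Gamma>) \<turnstile> \<Delta>] (insert (Conj \<phi> \<psi>) \<Gamma> \<turnstile> \<Delta>)"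
| ConjR: "infer Plain [\<Gamma> \<turnstile> insert \<phi> \<Delta>, \<Gamma> \<turnstile> insert \<psi> \<Delta>] (\<Gamma> \<turnstile> insert (Conj \<phi> \<psi>) \<Delta>)"
| DisjL: "infer Plain [insert \<phi> \<Gamma> \<turnstile> \<Delta>, insert \<psi> \<Gamma> \<turnstile> \<Delta>] (insert (Disj \<phi> \<psi>) \<Gamma> \<turnstile> \<Delta>)"
| DisjR: "infer Plain [\<Gamma> \<turnstile> insert \<phi> (insert \<psi> \<Delta>)] (\<Gamma> \<turnstile> insert (Disj \<phi> \<psi>) \<Delta>)"
| ImpL: "infer Plain [\<Gamma> \<turnstile> insert \<phi> \<Delta>, insert \<psi> \<Gamma> \<turnstile> \<Delta>] (insert (Imp \<phi> \<psi>) \<Gamma> \<turnstile> \<Delta>)"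
| ImpR: "infer Plain [insert \<phi> \<Gamma> \<turnstile> insert \<psi> \<Delta>] (\<Gamma> \<turnstile> insert (Imp \<phi> \<psi>) \<Delta>)"
| ForallL: "infer Plain [insert (inst \<phi> t) \<Gamma> \<turnstile> \<Delta>] (insert (Forall \<phi>) \<Gamma> \<turnstile> \<Delta>)"
| ForallR: "z \<notin> fvs (insert (Forall \<phi>) (\<Gamma> \<union> \<Delta>)) \<Longrightarrow>
    infer Plain [\<Gamma> \<turnstile> insert (inst \<phi> (Var z)) \<Delta>] (\<Gamma> \<turnstile> insert (Forall \<phi>) \<Delta>)"
| ExistsL: "z \<notin> fvs (insert (Exists \<phi>) (\<Gamma> \<union> \<Delta>)) \<Longrightarrow>
    infer Plain [insert (inst \<phi> (Var z)) \<Gamma> \<turnstile> \<Delta>] (insert (Exists \<phi>) \<Gamma> \<turnstile> \<Delta>)"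
| ExistsR: "infer Plain [\<Gamma> \<turnstile> insert (inst \<phi> t) \<Delta>] (\<Gamma> \<turnstile> insert (Exists \<phi>) \<Delta>)"
| EqL1: "infer Plain [\<Gamma> \<turnstile> insert (subst (Var(x := s)) \<phi>) \<Delta>]
    (insert (Eq s t) \<Gamma> \<turnstile> insert (subst (Var(x := t)) \<phi>) \<Delta>)"
| EqL2: "infer Plain [\<Gamma> \<turnstile> insert (subst (Var(x := t)) \<phi>) \<Delta>]
    (insert (Eq s t) \<Gamma> \<turnstile> insert (subst (Var(x := s)) \<phi>) \<Delta>)"
| EqR: "infer Plain [] ({} \<turnstile> {Eq t t})"
| Cut: "infer Plain [\<Gamma> \<turnstile> insert \<phi> \<Delta>, insert \<phi> \<Gamma> \<turnstile> \<Delta>] (\<Gamma> \<turnstile> \<Delta>)"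
| Subst: "infer (SubstBy \<theta>) [\<Gamma> \<turnstile> \<Delta>] (subst \<theta> ` \<Gamma> \<turnstile> subst \<theta> ` \<Delta>)"
| Refl: "infer Plain [] (\<Gamma> \<turnstile> insert (RTC \<phi> s s) \<Delta>)"
| Trans: "infer Plain [\<Gamma> \<turnstile> insert (RTC \<phi> s r) \<Delta>, \<Gamma> \<turnstile> insert (inst2 \<phi> r t) \<Delta>]
    (\<Gamma> \<turnstile> insert (RTC \<phi> s t) \<Delta>)"
| Case: "z \<notin> fvs (insert (RTC \<phi> s t) (\<Gamma> \<union> \<Delta>)) \<Longrightarrow>
    infer (CaseOn \<phi> s t z)
      [insert (Eq s t) \<Gamma> \<turnstile> \<Delta>,
       insert (RTC \<phi> s (Var z)) (insert (inst2 \<phi> (Var z) t) \<Gamma>) \<turnstile> \<Delta>]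
      (insert (RTC \<phi> s t) \<Gamma> \<turnstile> \<Delta>)"

codatatype ('f, 'p) deriv =
  Deriv (concl: "('f, 'p) sequent") (label: "('f, 'p) label") (prems: "('f, 'p) deriv list")

coinductive preproof :: "('f, 'p) signature \<Rightarrow> ('f, 'p) deriv \<Rightarrow> bool" for L where
  "\<lbrakk>wf_sequent L S; infer r (map concl ds) S; \<forall>d\<in>set ds. preproof L d\<rbrakk> \<Longrightarrow>
     preproof L (Deriv S r ds)"

definition progressing :: "('f, 'p) label \<Rightarrow> ('f, 'p) fm \<Rightarrow> ('f, 'p) fm \<Rightarrow> bool" where
  "progressing r \<tau> \<tau>' \<longleftrightarrow>
     (\<exists>\<phi> s t z. r = CaseOn \<phi> s t z \<and> \<tau> = RTC \<phi> s t \<and> \<tau>' = RTC \<phi> s (Var z))"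

text \<open>
  \<open>trace_pair S r S' \<tau> \<tau>'\<close>: trace pair for an instance of a rule with conclusion \<open>S\<close>, label \<open>r\<close> and
  \<open>S'\<close> among its premises.  For (Case), freshness of \<open>z\<close> ensures that the immediate ancestor can
  only occur in the second premise.
\<close>

definition trace_pair ::
  "('f, 'p) sequent \<Rightarrow> ('f, 'p) label \<Rightarrow> ('f, 'p) sequent \<Rightarrow> ('f, 'p) fm \<Rightarrow> ('f, 'p) fm \<Rightarrow> bool"
where
  "trace_pair S r S' \<tau> \<tau>' \<longleftrightarrow>
     is_RTC \<tau> \<and> is_RTC \<tau>' \<and> \<tau> \<in> ante S \<and> \<tau>' \<in> ante S' \<and>
     (case r of
        SubstBy \<theta> \<Rightarrow> \<tau> = subst \<theta> \<tau>'
      | CaseOn _ _ _ _ \<Rightarrow> progressing r \<tau> \<tau>' \<or> \<tau> = \<tau>'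
      | Plain \<Rightarrow> \<tau> = \<tau>')"

definition infinite_path :: "('f, 'p) deriv \<Rightarrow> (nat \<Rightarrow> ('f, 'p) deriv) \<Rightarrow> bool" where
  "infinite_path d p \<longleftrightarrow> p 0 = d \<and> (\<forall>i. p (Suc i) \<in> set (prems (p i)))"

text \<open>The trace \<open>\<tau>\<close> follows the path \<open>p\<close> from its \<open>k\<close>-th sequent on.\<close>

definition trace_follows ::
  "(nat \<Rightarrow> ('f, 'p) deriv) \<Rightarrow> nat \<Rightarrow> (nat \<Rightarrow> ('f, 'p) fm) \<Rightarrow> bool" where
  "trace_follows p k \<tau> \<longleftrightarrow>
     (\<forall>i. trace_pair (concl (p (i + k))) (label (p (i + k))) (concl (p (Suc (i + k))))
            (\<tau> i) (\<tau> (Suc i)))"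

definition infinitely_progressing ::
  "(nat \<Rightarrow> ('f, 'p) deriv) \<Rightarrow> nat \<Rightarrow> (nat \<Rightarrow> ('f, 'p) fm) \<Rightarrow> bool" where
  "infinitely_progressing p k \<tau> \<longleftrightarrow>
     (\<exists>\<^sub>\<infinity>i. progressing (label (p (i + k))) (\<tau> i) (\<tau> (Suc i)))"

definition is_proof :: "('f, 'p) signature \<Rightarrow> ('f, 'p) deriv \<Rightarrow> bool" where
  "is_proof L d \<longleftrightarrow> preproof L d \<and>
     (\<forall>p. infinite_path d p \<longrightarrow> (\<exists>k \<tau>. trace_follows p k \<tau> \<and> infinitely_progressing p k \<tau>))"

definition provable :: "('f, 'p) signature \<Rightarrow> ('f, 'p) sequent \<Rightarrow> bool" where
  "provable L S \<longleftrightarrow> (\<exists>d. is_proof L d \<and> concl d = S)"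

end

theory Submission
  imports Defs
begin

text \<open>
  Infinite proofs make an \<open>\<omega>\<close>-rule for \<open>RTC\<close> derivable: if \<open>\<Gamma>\<close> together with each finite chain
  \<open>s = z\<^sub>n, \<phi>(z\<^sub>n, z\<^sub>n\<^sub>-\<^sub>1), \<dots>, \<phi>(z\<^sub>1, t)\<close> of fresh variables proves \<open>\<Delta>\<close>, then so does \<open>\<Gamma>\<close> together with
  \<open>RTC \<phi> s t\<close>.  Hence an unprovable sequent containing \<open>RTC \<phi> s t\<close> on the left stays unprovable
  after adding a suitable finite chain.  This is the witness property needed for a Henkin
  construction: by Cut, an unprovable sequent extends to a maximal theory with witnesses for
  \<open>\<exists>\<close>, \<open>\<not>\<forall>\<close> and \<open>RTC\<close>, and the quotient of its term model by provable equality, embedded into the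
  given infinite type, is a standard countermodel.
\<close>

section \<open>Substitution\<close>

lemma lift_subst_simps [simp]:
  "lift_subst \<theta> 0 = Var 0"
  "lift_subst \<theta> (Suc n) = subst_tm (\<lambda>m. Var (Suc m)) (\<theta> n)"
  by (simp_all add: lift_subst_def)

lemma subst_tm_cong:
  "(\<And>n. n \<in> fv_tm t \<Longrightarrow> \<theta> n = \<theta>' n) \<Longrightarrow> subst_tm \<theta> t = subst_tm \<theta>' t"
  by (induction t) auto

lemma subst_tm_Var [simp]: "subst_tm Var t = t"
  by (induction t) (auto simp: map_idI)

lemma subst_tm_subst_tm:
  "subst_tm \<sigma> (subst_tm \<theta> t) = subst_tm (\<lambda>n. subst_tm \<sigma> (\<theta> n)) t"
  by (induction t) auto

lemma lift_subst_Var [simp]: "lift_subst Var = Var"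
  by (rule ext) (simp add: lift_subst_def split: nat.split)

lemma lift_subst_comp:
  "(\<lambda>n. subst_tm (lift_subst \<sigma>) (lift_subst \<theta> n)) = lift_subst (\<lambda>n. subst_tm \<sigma> (\<theta> n))"
proof
  fix n
  show "subst_tm (lift_subst \<sigma>) (lift_subst \<theta> n) = lift_subst (\<lambda>n. subst_tm \<sigma> (\<theta> n)) n"
    by (cases n) (auto simp: subst_tm_subst_tm)
qed

lemma subst_Var [simp]: "subst Var \<phi> = \<phi>"
  by (induction \<phi>) (auto simp: map_idI)

lemma subst_subst: "subst \<sigma> (subst \<theta> \<phi>) = subst (\<lambda>n. subst_tm \<sigma> (\<theta> n)) \<phi>"
  by (induction \<phi> arbitrary: \<sigma> \<theta>) (auto simp: subst_tm_subst_tm lift_subst_comp)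

lemma subst_cong:
  "(\<And>n. n \<in> fv \<phi> \<Longrightarrow> \<theta> n = \<theta>' n) \<Longrightarrow> subst \<theta> \<phi> = subst \<theta>' \<phi>"
proof (induction \<phi> arbitrary: \<theta> \<theta>')
  case (Pred p ts)
  then show ?case by (auto intro!: subst_tm_cong)
next
  case (Eq s t)
  then show ?case by (auto intro!: subst_tm_cong)
next
  case (Conj \<phi> \<psi>)
  show ?case using Conj.prems by (auto intro!: Conj.IH)
next
  case (Disj \<phi> \<psi>)
  show ?case using Disj.prems by (auto intro!: Disj.IH)
next
  case (Imp \<phi> \<psi>)
  show ?case using Imp.prems by (auto intro!: Imp.IH)
next
  case (Forall \<phi>)
  have "lift_subst \<theta> n = lift_subst \<theta>' n" if "n \<in> fv \<phi>" for n
    using that Forall.prems by (cases n) auto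
  then have "subst (lift_subst \<theta>) \<phi> = subst (lift_subst \<theta>') \<phi>"
    by (rule Forall.IH)
  then show ?case by simp
next
  case (Exists \<phi>)
  have "lift_subst \<theta> n = lift_subst \<theta>' n" if "n \<in> fv \<phi>" for n
    using that Exists.prems by (cases n) auto
  then have "subst (lift_subst \<theta>) \<phi> = subst (lift_subst \<theta>') \<phi>"
    by (rule Exists.IH)
  then show ?case by simp
next
  case (RTC \<phi> s t)
  have "lift_subst (lift_subst \<theta>) n = lift_subst (lift_subst \<theta>') n" if "n \<in> fv \<phi>" for n
  proof (cases n)
    case (Suc m)
    then show ?thesis using that RTC.prems by (cases m) auto
  qed simp
  then have "subst (lift_subst (lift_subst \<theta>)) \<phi> = subst (lift_subst (lift_subst \<theta>')) \<phi>"
    by (rule RTC.IH)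
  then show ?case using RTC.prems by (auto intro!: subst_tm_cong)
next
  case (Neg \<phi>)
  show ?case using Neg.prems by (auto intro!: Neg.IH)
qed

lemma subst_tm_fresh [simp]: "x \<notin> fv_tm t \<Longrightarrow> subst_tm (Var(x := s)) t = t"
  using subst_tm_cong[of t "Var(x := s)" Var] by fastforce

lemma subst_fresh: "x \<notin> fv \<phi> \<Longrightarrow> subst (Var(x := s)) \<phi> = \<phi>"
  using subst_cong[of \<phi> "Var(x := s)" Var] by fastforce

lemma subst_tm_fresh_map [simp]:
  "x \<notin> \<Union> (fv_tm ` set ts) \<Longrightarrow> map (subst_tm (Var(x := s))) ts = ts"
  by (auto intro!: map_idI)

text \<open>Substituting under the binder and then instantiating extends the environment by one
  term. This is the form in which the induction over formulas meets instances of a quantified body;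
  \<open>inst2_lift_subst\<close> does the same for the two indices bound by
  \<open>RTC\<close>.\<close>

lemma inst_lift_subst: "inst (subst (lift_subst \<sigma>) \<phi>) t = subst (case_nat t \<sigma>) \<phi>"
  unfolding inst_def subst_subst
proof (rule arg_cong[where f = "\<lambda>\<theta>. subst \<theta> \<phi>"], rule ext)
  fix n
  show "subst_tm (case_nat t Var) (lift_subst \<sigma> n) = case_nat t \<sigma> n"
    by (cases n) (auto simp: subst_tm_subst_tm)
qed

lemma inst2_lift_subst:
  "inst2 (subst (lift_subst (lift_subst \<sigma>)) \<phi>) s t = subst (case_nat s (case_nat t \<sigma>)) \<phi>"
  unfolding inst2_def subst_subst
proof (rule arg_cong[where f = "\<lambda>\<theta>. subst \<theta> \<phi>"], rule ext)
  fix n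
  show "subst_tm (case_nat s (case_nat t Var)) (lift_subst (lift_subst \<sigma>) n)
      = case_nat s (case_nat t \<sigma>) n"
    by (auto simp: subst_tm_subst_tm lift_subst_def split: nat.split)
qed

section \<open>Free variables, well-formedness and countability of the syntax\<close>

lemma finite_fv_tm [simp]: "finite (fv_tm t)"
  by (induction t) auto

lemma finite_fv [simp]: "finite (fv \<phi>)"
proof (induction \<phi>)
  case (Forall \<phi>)
  then show ?case using finite_vimageI[of "fv \<phi>" Suc] by (simp add: vimage_def)
next
  case (Exists \<phi>)
  then show ?case using finite_vimageI[of "fv \<phi>" Suc] by (simp add: vimage_def)
next
  case (RTC \<phi> s t)
  then show ?case
    using finite_vimageI[of "fv \<phi>" "\<lambda>n. Suc (Suc n)"] by (simp add: vimage_def inj_def)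
qed auto

lemma fv_subst_tm: "fv_tm (subst_tm \<sigma> t) = (\<Union>n\<in>fv_tm t. fv_tm (\<sigma> n))"
  by (induction t) auto

lemma fv_lift_subst: "Suc n \<in> fv_tm (lift_subst \<sigma> m) \<longleftrightarrow> (\<exists>k. m = Suc k \<and> n \<in> fv_tm (\<sigma> k))"
  by (cases m) (auto simp: fv_subst_tm)

lemma fv_subst: "n \<in> fv (subst \<sigma> \<phi>) \<longleftrightarrow> (\<exists>m\<in>fv \<phi>. n \<in> fv_tm (\<sigma> m))"
proof (induction \<phi> arbitrary: \<sigma> n)
  case (Forall \<phi>)
  then show ?case by (force simp: fv_lift_subst)
next
  case (Exists \<phi>)
  then show ?case by (force simp: fv_lift_subst)
next
  case (RTC \<phi> s t)
  then show ?case by (force simp: fv_lift_subst fv_subst_tm)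
qed (auto simp: fv_subst_tm)

text \<open>Limits the variables that a chain formula can introduce. Equality may fail:
  \<open>s\<close> or \<open>t\<close> disappears when the index it replaces does not occur in
  \<open>\<phi>\<close>.\<close>

lemma fv_inst2: "fv (inst2 \<phi> s t) \<subseteq> fv (RTC \<phi> s t)"
proof
  fix x assume "x \<in> fv (inst2 \<phi> s t)"
  then obtain m where m: "m \<in> fv \<phi>" "x \<in> fv_tm (case_nat s (case_nat t Var) m)"
    by (auto simp: inst2_def fv_subst)
  \<comment> \<open>Index \<open>0\<close> stands for \<open>s\<close>, index \<open>1\<close> for
    \<open>t\<close>, and larger indices for the context shifted by two.\<close>
  then show "x \<in> fv (RTC \<phi> s t)"
    by (cases m; cases "m - 1") auto
qed

lemma ex_fresh: "finite A \<Longrightarrow> \<exists>x::nat. x \<notin> A"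
  by (rule ex_new_if_finite) auto

lemma wf_subst_tm: "wf_tm L t \<Longrightarrow> (\<And>n. wf_tm L (\<sigma> n)) \<Longrightarrow> wf_tm L (subst_tm \<sigma> t)"
  by (induction t) auto

lemma wf_lift_subst: "(\<And>n. wf_tm L (\<sigma> n)) \<Longrightarrow> wf_tm L (lift_subst \<sigma> n)"
  by (auto simp: lift_subst_def wf_subst_tm split: nat.split)

lemma wf_subst: "wf_fm L \<phi> \<Longrightarrow> (\<And>n. wf_tm L (\<sigma> n)) \<Longrightarrow> wf_fm L (subst \<sigma> \<phi>)"
  by (induction \<phi> arbitrary: \<sigma>) (auto simp: wf_subst_tm wf_lift_subst)

lemma wf_inst: "wf_fm L \<phi> \<Longrightarrow> wf_tm L t \<Longrightarrow> wf_fm L (inst \<phi> t)"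
  unfolding inst_def by (rule wf_subst) (auto split: nat.split)

lemma wf_inst2: "wf_fm L \<phi> \<Longrightarrow> wf_tm L s \<Longrightarrow> wf_tm L t \<Longrightarrow> wf_fm L (inst2 \<phi> s t)"
  unfolding inst2_def by (rule wf_subst) (auto split: nat.split)

instance tm :: (countable) countable
  by countable_datatype

instance fm :: (countable, countable) countable
  by countable_datatype

lemma wf_tm_symbols: "wf_tm L t \<Longrightarrow> set_tm t \<subseteq> dom (fun_arity L)"
  by (induction t) auto

lemma wf_fm_symbols:
  "wf_fm L \<phi> \<Longrightarrow> set1_fm \<phi> \<subseteq> dom (fun_arity L) \<and> set2_fm \<phi> \<subseteq> dom (pred_arity L)"
proof (induction \<phi>)
  case (Pred p ts)
  then show ?case using wf_tm_symbols by fastforce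
qed (simp_all add: wf_tm_symbols)

text \<open>A well-formed term contains only symbols that have an arity. Numbering these countably
  many symbols therefore maps the terms injectively into terms over \<open>nat\<close>, a countable
  type.\<close>

lemma countable_wf_tm:
  assumes "countable_signature L"
  shows "countable {t. wf_tm L t}"
proof -
  have "inj_on (map_tm (to_nat_on (dom (fun_arity L)))) {t. wf_tm L t}"
  proof (rule inj_onI, erule tm.inj_map_strong[rotated])
    fix t t' f g
    assume "t \<in> {t. wf_tm L t}" "t' \<in> {t. wf_tm L t}" "f \<in> set_tm t" "g \<in> set_tm t'"
      "to_nat_on (dom (fun_arity L)) f = to_nat_on (dom (fun_arity L)) g"
    then show "f = g"
      using assms wf_tm_symbols[of L t] wf_tm_symbols[of L t']
      by (auto simp: countable_signature_def dest!: inj_onD[OF inj_on_to_nat_on])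
  qed
  then show ?thesis by (rule countableI')
qed

lemma countable_wf_fm:
  assumes "countable_signature L"
  shows "countable {\<phi>. wf_fm L \<phi>}"
proof -
  have "inj_on (map_fm (to_nat_on (dom (fun_arity L))) (to_nat_on (dom (pred_arity L))))
    {\<phi>. wf_fm L \<phi>}"
  proof (rule inj_onI, erule fm.inj_map_strong[rotated 2])
    fix \<phi> \<psi> f g
    assume "\<phi> \<in> {\<phi>. wf_fm L \<phi>}" "\<psi> \<in> {\<phi>. wf_fm L \<phi>}" "f \<in> set1_fm \<phi>" "g \<in> set1_fm \<psi>"
      "to_nat_on (dom (fun_arity L)) f = to_nat_on (dom (fun_arity L)) g"
    then show "f = g"
      using assms wf_fm_symbols[of L \<phi>] wf_fm_symbols[of L \<psi>]
      by (auto simp: countable_signature_def dest!: inj_onD[OF inj_on_to_nat_on])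
  next
    fix \<phi> \<psi> p q
    assume "\<phi> \<in> {\<phi>. wf_fm L \<phi>}" "\<psi> \<in> {\<phi>. wf_fm L \<phi>}" "p \<in> set2_fm \<phi>" "q \<in> set2_fm \<psi>"
      "to_nat_on (dom (pred_arity L)) p = to_nat_on (dom (pred_arity L)) q"
    then show "p = q"
      using assms wf_fm_symbols[of L \<phi>] wf_fm_symbols[of L \<psi>]
      by (auto simp: countable_signature_def dest!: inj_onD[OF inj_on_to_nat_on])
  qed
  then show ?thesis by (rule countableI')
qed

section \<open>Closure properties of provability\<close>

lemma infinite_path_tail: "infinite_path d p \<Longrightarrow> infinite_path (p j) (\<lambda>i. p (i + j))"
  by (simp add: infinite_path_def)

text \<open>A trace may begin at any position, so a trace for the tail, with its start moved by
  \<open>j\<close>, serves for the whole path.\<close>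

lemma is_proof_tail:
  assumes "infinite_path d p" "is_proof L (p j)"
  shows "\<exists>k \<tau>. trace_follows p k \<tau> \<and> infinitely_progressing p k \<tau>"
proof -
  obtain k \<tau> where "trace_follows (\<lambda>i. p (i + j)) k \<tau>"
    "infinitely_progressing (\<lambda>i. p (i + j)) k \<tau>"
    using assms infinite_path_tail unfolding is_proof_def by blast
  then have "trace_follows p (k + j) \<tau>" "infinitely_progressing p (k + j) \<tau>"
    by (simp_all add: trace_follows_def infinitely_progressing_def add.assoc)
  then show ?thesis by blast
qed

lemma provable_wf: "provable L S \<Longrightarrow> wf_sequent L S"
  unfolding provable_def is_proof_def by (auto elim: preproof.cases)

text \<open>Every infinite path through the new root lies in a proof of some premise after one step,
  and the trace condition disregards that step.\<close>

lemma provable_rule: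
  assumes "infer r Ss S" "wf_sequent L S" "\<forall>S'\<in>set Ss. provable L S'"
  shows "provable L S"
proof -
  obtain D where D: "\<forall>S'\<in>set Ss. is_proof L (D S') \<and> concl (D S') = S'"
    using assms(3) unfolding provable_def by metis
  define d where "d = Deriv S r (map D Ss)"
  have "map concl (map D Ss) = Ss"
    using D by (auto intro!: map_idI)
  then have "preproof L d"
    using assms(1,2) D unfolding d_def by (auto intro!: preproof.intros simp: is_proof_def)
  moreover have "\<exists>k \<tau>. trace_follows p k \<tau> \<and> infinitely_progressing p k \<tau>"
    if "infinite_path d p" for p
  proof -
    have "p (Suc 0) \<in> set (prems (p 0))" "p 0 = d"
      using that unfolding infinite_path_def by blast+
    then have "is_proof L (p 1)"
      using D by (auto simp: d_def)
    then show ?thesis using that is_proof_tail by blast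
  qed
  ultimately have "is_proof L d" unfolding is_proof_def by blast
  then show ?thesis unfolding provable_def d_def by force
qed

lemma provable_weaken_ante:
  assumes "finite C" "\<forall>\<phi>\<in>C. wf_fm L \<phi>" "provable L (A \<turnstile> B)"
  shows "provable L (C \<union> A \<turnstile> B)"
  using assms(1,2)
proof induction
  case (insert \<phi> C)
  then have "provable L (C \<union> A \<turnstile> B)" by simp
  with insert.prems show ?case
    unfolding Un_insert_left
    by (intro provable_rule[OF infer.WeakL]) (auto dest!: provable_wf simp: wf_sequent_def)
qed (use assms(3) in simp)

lemma provable_weaken_succ:
  assumes "finite C" "\<forall>\<phi>\<in>C. wf_fm L \<phi>" "provable L (A \<turnstile> B)"
  shows "provable L (A \<turnstile> C \<union> B)"
  using assms(1,2)
proof induction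
  case (insert \<phi> C)
  then have "provable L (A \<turnstile> C \<union> B)" by simp
  with insert.prems show ?case
    unfolding Un_insert_left
    by (intro provable_rule[OF infer.WeakR]) (auto dest!: provable_wf simp: wf_sequent_def)
qed (use assms(3) in simp)

lemma provable_weaken:
  assumes "provable L (A \<turnstile> B)" "A \<subseteq> A'" "B \<subseteq> B'" "wf_sequent L (A' \<turnstile> B')"
  shows "provable L (A' \<turnstile> B')"
proof -
  have "provable L (A' \<union> A \<turnstile> B' \<union> B)"
    using assms by (intro provable_weaken_ante provable_weaken_succ) (auto simp: wf_sequent_def)
  then show ?thesis using assms by (simp add: Un_absorb2)
qed

lemma provable_ax:
  assumes "\<phi> \<in> A" "\<phi> \<in> B" "wf_sequent L (A \<turnstile> B)"
  shows "provable L (A \<turnstile> B)"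
proof (rule provable_weaken)
  show "provable L ({\<phi>} \<turnstile> {\<phi>})"
    using assms by (intro provable_rule[OF infer.Ax]) (auto simp: wf_sequent_def)
qed (use assms in auto)

section \<open>Infinite unfolding of an \<open>RTC\<close>-formula\<close>

primcorec spine ::
  "(nat \<Rightarrow> ('f, 'p) sequent) \<Rightarrow> (nat \<Rightarrow> ('f, 'p) label) \<Rightarrow> (nat \<Rightarrow> ('f, 'p) deriv) \<Rightarrow> nat \<Rightarrow>
    ('f, 'p) deriv"
where
  "spine S r D n = Deriv (S n) (r n) [D n, spine S r D (Suc n)]"

text \<open>An infinite path either turns left at some node and continues in a given proof, or it is
  the right branch. On the right branch each \<open>RTC \<phi> s (r n)\<close> is principal and the
  next one is its immediate ancestor, so the trace progresses at every step.\<close>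

lemma provable_Case_spine:
  assumes infer: "\<And>n. infer (CaseOn \<phi> s (r n) (z n)) [P n, S (Suc n)] (S n)"
    and wf: "\<And>n. wf_sequent L (S n)"
    and prov: "\<And>n. provable L (P n)"
    and mem: "\<And>n. RTC \<phi> s (r n) \<in> ante (S n)"
    and r: "\<And>n. r (Suc n) = Var (z n)"
  shows "provable L (S 0)"
proof -
  obtain D where D: "\<And>n. is_proof L (D n)" "\<And>n. concl (D n) = P n"
    using prov unfolding provable_def by metis
  define E where "E = spine S (\<lambda>n. CaseOn \<phi> s (r n) (z n)) D"
  have E: "E n = Deriv (S n) (CaseOn \<phi> s (r n) (z n)) [D n, E (Suc n)]" for n
    unfolding E_def by (rule spine.code)
  \<comment> \<open>As a rewrite rule \<open>E\<close> would unfold forever; the selector equations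
    terminate.\<close>
  have E_sel [simp]: "concl (E n) = S n" "label (E n) = CaseOn \<phi> s (r n) (z n)"
    "prems (E n) = [D n, E (Suc n)]" for n
    by (subst E, simp)+
  have "preproof L (E 0)"
  proof (rule preproof.coinduct[where X = "\<lambda>d. \<exists>n. d = E n"])
    fix d assume "\<exists>n. d = E n"
    then obtain n where "d = E n" ..
    then show "\<exists>S r ds. d = Deriv S r ds \<and> wf_sequent L S \<and> infer r (map concl ds) S \<and>
        (\<forall>d\<in>set ds. (\<exists>n. d = E n) \<or> preproof L d)"
      using infer[of n] wf[of n] D[of n]
      by (intro exI conjI) (rule trans[OF _ E], auto simp: is_proof_def)
  qed blast
  moreover have "\<exists>k \<tau>. trace_follows p k \<tau> \<and> infinitely_progressing p k \<tau>"
    if path: "infinite_path (E 0) p" for p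
  \<comment> \<open>A left turn made at node \<open>n\<close> puts \<open>D n\<close> at position
    \<open>n + 1\<close> of the path. The case \<open>n = 0\<close>, where the subtraction
    truncates, does no harm: \<open>D 0\<close> is a proof as well.\<close>
  proof (cases "\<exists>n. p n = D (n - 1)")
    case True
    then show ?thesis using D(1) is_proof_tail[OF path] by metis
  next
    case False
    have pE: "p n = E n" for n
    proof (induction n)
      case (Suc n)
      have "p (Suc n) \<in> set (prems (p n))" using path by (simp add: infinite_path_def)
      then show ?case using Suc False by (metis E_sel(3) diff_Suc_1 empty_iff empty_set set_ConsD)
    qed (use path in \<open>simp add: infinite_path_def\<close>)
    have "progressing (CaseOn \<phi> s (r i) (z i)) (RTC \<phi> s (r i)) (RTC \<phi> s (r (Suc i)))" for i
      by (simp add: progressing_def r)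
    then have "trace_follows p 0 (\<lambda>n. RTC \<phi> s (r n))"
      "infinitely_progressing p 0 (\<lambda>n. RTC \<phi> s (r n))"
      unfolding trace_follows_def trace_pair_def infinitely_progressing_def
      using mem by (simp_all add: pE)
    then show ?thesis by blast
  qed
  ultimately have "is_proof L (E 0)" unfolding is_proof_def by blast
  then show ?thesis unfolding provable_def using E_sel(1) by blast
qed

text \<open>
  This is where infinite proofs enter: unfolding \<open>RTC \<phi> s t\<close> by (Case) again and again, and closing
  the left premises by the given proofs, only adds one infinite path, which is progressing.
\<close>

lemma not_provable_RTC_chain:
  assumes wf: "wf_sequent L (insert (RTC \<phi> s t) \<Gamma> \<turnstile> \<Delta>)"
    and np: "\<not> provable L (insert (RTC \<phi> s t) \<Gamma> \<turnstile> \<Delta>)"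
  shows "\<exists>n r. r 0 = t \<and> (\<forall>i. wf_tm L (r i)) \<and>
    \<not> provable L (insert (Eq s (r n)) (\<Gamma> \<union> (\<lambda>i. inst2 \<phi> (r (Suc i)) (r i)) ` {..<n}) \<turnstile> \<Delta>)"
proof (rule ccontr)
  assume contr: "\<not> ?thesis"
  have "finite (fvs (insert (RTC \<phi> s t) (\<Gamma> \<union> \<Delta>)))"
    using wf by (auto simp: wf_sequent_def simp del: fv.simps)
  then have "\<exists>N. \<forall>x\<in>fvs (insert (RTC \<phi> s t) (\<Gamma> \<union> \<Delta>)). x < N"
    by (simp only: finite_nat_set_iff_bounded)
  then obtain N where N: "\<And>x. x \<in> fvs (insert (RTC \<phi> s t) (\<Gamma> \<union> \<Delta>)) \<Longrightarrow> x < N"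
    by metis
  \<comment> \<open>(Case) splits off the last step of a chain, so the chain is listed backwards
    from \<open>t\<close>, continuing with the variables from \<open>N\<close> on.\<close>
  define r where "r = case_nat t (\<lambda>i. Var (N + i))"
  have r: "r 0 = t" "r (Suc i) = Var (N + i)" for i
    by (simp_all add: r_def)
  have wf_r: "wf_tm L (r i)" for i
    using wf by (cases i) (auto simp: r wf_sequent_def)
  define G where "G n = \<Gamma> \<union> (\<lambda>i. inst2 \<phi> (r (Suc i)) (r i)) ` {..<n}" for n
  have G_Suc: "G (Suc n) = insert (inst2 \<phi> (Var (N + n)) (r n)) (G n)" for n
    by (auto simp: G_def r lessThan_Suc)
  have wf_G: "wf_sequent L (insert (RTC \<phi> s (r n)) (G n) \<turnstile> \<Delta>)" for n
    using wf wf_r by (auto simp: wf_sequent_def G_def wf_inst2)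
  \<comment> \<open>Stage \<open>n\<close> contains only free variables below \<open>N + n\<close>,
    which makes \<open>N + n\<close> an admissible eigenvariable there.\<close>
  have fv_RTC: "x < N + n" if "x \<in> fv (RTC \<phi> s (r n))" for x n
    using that N[of x] by (cases n) (auto simp: r)
  have fv_G: "x < N + n" if "x \<in> fvs (G n)" for x n
  proof -
    have "x < N + n" if "i < n" "x \<in> fv (inst2 \<phi> (r (Suc i)) (r i))" for i
    proof -
      have "x \<in> fv (RTC \<phi> s (r i)) \<union> {N + i}"
        using that(2) fv_inst2[of \<phi> "r (Suc i)" "r i"] by (auto simp: r)
      then show ?thesis using fv_RTC[of x i] that(1) by auto
    qed
    moreover have "x < N + n" if "x \<in> fvs \<Gamma>"
      using N[of x] that by (simp add: trans_less_add1)
    ultimately show ?thesis using that by (auto simp: G_def)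
  qed
  have "provable L (insert (RTC \<phi> s (r 0)) (G 0) \<turnstile> \<Delta>)"
  proof (rule provable_Case_spine[where S = "\<lambda>n. insert (RTC \<phi> s (r n)) (G n) \<turnstile> \<Delta>"
        and z = "\<lambda>n. N + n" and P = "\<lambda>n. insert (Eq s (r n)) (G n) \<turnstile> \<Delta>"])
    fix n
    have "N + n \<notin> fvs (insert (RTC \<phi> s (r n)) (G n \<union> \<Delta>))"
      using fv_RTC[of "N + n" n] fv_G[of "N + n" n] N[of "N + n"] by (auto simp del: fv.simps)
    then show "infer (CaseOn \<phi> s (r n) (N + n))
        [insert (Eq s (r n)) (G n) \<turnstile> \<Delta>, insert (RTC \<phi> s (r (Suc n))) (G (Suc n)) \<turnstile> \<Delta>]
        (insert (RTC \<phi> s (r n)) (G n) \<turnstile> \<Delta>)"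
      unfolding G_Suc r(2) by (rule infer.Case)
    \<comment> \<open>The negated claim says precisely that each of these left premises is
      provable.\<close>
    show "provable L (insert (Eq s (r n)) (G n) \<turnstile> \<Delta>)"
      using contr r(1) wf_r unfolding G_def by blast
  qed (use wf_G r in auto)
  then show False using np by (simp add: G_def r)
qed

section \<open>Extension to a maximal theory\<close>

text \<open>Describes a sequent that has decided \<open>\<chi>\<close> and, where the decision calls
  for it, contains a witness. For \<open>RTC\<close> the witness is a finite chain, again listed
  from \<open>t\<close> back to a term equated with \<open>s\<close>.\<close>

definition henkin_step ::
  "('f, 'p) signature \<Rightarrow> ('f, 'p) fm \<Rightarrow> ('f, 'p) sequent \<Rightarrow> bool" where
  "henkin_step L \<chi> S \<longleftrightarrow> \<chi> \<in> ante S \<union> succ S \<and>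
     (\<forall>\<phi>. \<chi> = Exists \<phi> \<and> \<chi> \<in> ante S \<longrightarrow> (\<exists>z. inst \<phi> (Var z) \<in> ante S)) \<and>
     (\<forall>\<phi>. \<chi> = Forall \<phi> \<and> \<chi> \<in> succ S \<longrightarrow> (\<exists>z. inst \<phi> (Var z) \<in> succ S)) \<and>
     (\<forall>\<phi> s t. \<chi> = RTC \<phi> s t \<and> \<chi> \<in> ante S \<longrightarrow>
        (\<exists>n r. r 0 = t \<and> (\<forall>i. wf_tm L (r i)) \<and> Eq s (r n) \<in> ante S \<and>
          (\<forall>i<n. inst2 \<phi> (r (Suc i)) (r i) \<in> ante S)))"

text \<open>Cut allows \<open>\<chi>\<close> to be added on one side. A witness is then added by
  reading the eigenvariable rules, or the chain property for \<open>RTC\<close>,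
  contrapositively.\<close>

lemma henkin_extend:
  assumes wf: "wf_sequent L (\<Gamma> \<turnstile> \<Delta>)" and np: "\<not> provable L (\<Gamma> \<turnstile> \<Delta>)" and wf_\<chi>: "wf_fm L \<chi>"
  shows "\<exists>S. wf_sequent L S \<and> \<not> provable L S \<and> \<Gamma> \<subseteq> ante S \<and> \<Delta> \<subseteq> succ S \<and> henkin_step L \<chi> S"
proof -
  \<comment> \<open>By the axiom no formula is on both sides, so only the witness conditions of the
    chosen side are at stake.\<close>
  have disjoint: "\<chi> \<notin> A \<or> \<chi> \<notin> B" if "\<not> provable L (A \<turnstile> B)" "wf_sequent L (A \<turnstile> B)" for A B
    using that provable_ax by blast
  consider (ante) "\<not> provable L (insert \<chi> \<Gamma> \<turnstile> \<Delta>)" | (succ) "\<not> provable L (\<Gamma> \<turnstile> insert \<chi> \<Delta>)"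
    using provable_rule[OF infer.Cut wf, of \<chi>] np by auto
  then show ?thesis
  proof cases
    case ante
    let ?S = "insert \<chi> \<Gamma> \<turnstile> \<Delta>"
    have wfS: "wf_sequent L ?S" using wf wf_\<chi> by (simp add: wf_sequent_def)
    have fin: "finite (fvs (insert \<chi> (insert \<chi> \<Gamma> \<union> \<Delta>)))"
      using wf by (simp add: wf_sequent_def)
    consider (Exists) \<phi> where "\<chi> = Exists \<phi>" | (RTC) \<phi> s t where "\<chi> = RTC \<phi> s t"
      | (other) "\<forall>\<phi>. \<chi> \<noteq> Exists \<phi>" "\<forall>\<phi> s t. \<chi> \<noteq> RTC \<phi> s t"
      by blast
    then show ?thesis
    proof cases
      case Exists
      obtain z where z: "z \<notin> fvs (insert \<chi> (insert \<chi> \<Gamma> \<union> \<Delta>))"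
        using ex_fresh[OF fin] ..
      let ?S' = "insert (inst \<phi> (Var z)) (insert \<chi> \<Gamma>) \<turnstile> \<Delta>"
      \<comment> \<open>The rule is applied with \<open>\<chi>\<close> also in its context, so that
        \<open>\<chi>\<close> survives in the premise.\<close>
      have "\<not> provable L ?S'"
        using provable_rule[OF infer.ExistsL[OF z[unfolded Exists]]] ante wfS
        by (auto simp: Exists)
      moreover have "wf_sequent L ?S'"
        using wfS by (simp add: wf_sequent_def Exists wf_inst)
      moreover have "\<chi> \<notin> \<Delta>" using disjoint[OF ante wfS] by simp
      ultimately show ?thesis by (intro exI[of _ ?S']) (auto simp: henkin_step_def Exists)
    next
      case RTC
      obtain n r where r: "r 0 = t" "\<forall>i. wf_tm L (r i)" and npS: "\<not> provable L (insert (Eq s (r n))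
          (insert \<chi> \<Gamma> \<union> (\<lambda>i. inst2 \<phi> (r (Suc i)) (r i)) ` {..<n}) \<turnstile> \<Delta>)"
        using not_provable_RTC_chain[of L \<phi> s t "insert \<chi> \<Gamma>" \<Delta>] ante wfS unfolding RTC by auto
      let ?S' = "insert (Eq s (r n))
          (insert \<chi> \<Gamma> \<union> (\<lambda>i. inst2 \<phi> (r (Suc i)) (r i)) ` {..<n}) \<turnstile> \<Delta>"
      have "wf_sequent L ?S'"
        using wfS r by (auto simp: wf_sequent_def RTC wf_inst2)
      moreover have "henkin_step L \<chi> ?S'"
        using r unfolding henkin_step_def RTC by auto
      ultimately show ?thesis using npS by (intro exI[of _ ?S']) auto
    next
      case other
      then have "henkin_step L \<chi> ?S"
        using disjoint[OF ante wfS] by (auto simp: henkin_step_def)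
      then show ?thesis using ante wfS by (intro exI[of _ ?S]) auto
    qed
  next
    case succ
    let ?S = "\<Gamma> \<turnstile> insert \<chi> \<Delta>"
    have wfS: "wf_sequent L ?S" using wf wf_\<chi> by (simp add: wf_sequent_def)
    have notin: "\<chi> \<notin> \<Gamma>" using disjoint[OF succ wfS] by simp
    have fin: "finite (fvs (insert \<chi> (\<Gamma> \<union> insert \<chi> \<Delta>)))"
      using wf by (simp add: wf_sequent_def)
    show ?thesis
    proof (cases "\<exists>\<phi>. \<chi> = Forall \<phi>")
      case True
      then obtain \<phi> where \<phi>: "\<chi> = Forall \<phi>" ..
      obtain z where z: "z \<notin> fvs (insert \<chi> (\<Gamma> \<union> insert \<chi> \<Delta>))"
        using ex_fresh[OF fin] ..
      let ?S' = "\<Gamma> \<turnstile> insert (inst \<phi> (Var z)) (insert \<chi> \<Delta>)"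
      have "\<not> provable L ?S'"
        using provable_rule[OF infer.ForallR[OF z[unfolded \<phi>]]] succ wfS by (auto simp: \<phi>)
      moreover have "wf_sequent L ?S'"
        using wfS by (simp add: wf_sequent_def \<phi> wf_inst)
      ultimately show ?thesis
        using notin by (intro exI[of _ ?S']) (auto simp: henkin_step_def \<phi>)
    next
      case False
      then have "henkin_step L \<chi> ?S"
        using notin by (auto simp: henkin_step_def)
      then show ?thesis using succ wfS by (intro exI[of _ ?S]) auto
    qed
  qed
qed

lemma finite_subset_UN_mono:
  assumes "finite A" "A \<subseteq> (\<Union>n. F n)" "mono (F :: nat \<Rightarrow> 'a set)"
  shows "\<exists>n. A \<subseteq> F n"
  using assms(1,2)
proof induction
  case (insert x A)
  then obtain m n where "A \<subseteq> F m" "x \<in> F n" by auto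
  moreover have "F m \<subseteq> F (max m n)" "F n \<subseteq> F (max m n)"
    using assms(3) by (simp_all add: monoD)
  ultimately show ?case by blast
qed simp

text \<open>\<open>closed\<close> combines consistency (the case of empty \<open>B\<close>), closure
  under derivability and the decision of every formula. \<open>RTC_chain\<close> excludes theories
  that assert reachability without any finite path, which is what makes the eventual model
  standard.\<close>

locale maximal_theory =
  fixes L :: "('f, 'p) signature" and T :: "('f, 'p) fm set"
  assumes closed: "provable L (A \<turnstile> B) \<Longrightarrow> A \<subseteq> T \<Longrightarrow> B \<inter> T \<noteq> {}"
    and Exists_witness: "wf_fm L (Exists \<phi>) \<Longrightarrow> Exists \<phi> \<in> T \<Longrightarrow> \<exists>z. inst \<phi> (Var z) \<in> T"
    and Forall_witness: "wf_fm L (Forall \<phi>) \<Longrightarrow> Forall \<phi> \<notin> T \<Longrightarrow> \<exists>z. inst \<phi> (Var z) \<notin> T"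
    and RTC_chain: "wf_fm L (RTC \<phi> s t) \<Longrightarrow> RTC \<phi> s t \<in> T \<Longrightarrow>
      \<exists>n r. r 0 = t \<and> (\<forall>i. wf_tm L (r i)) \<and> Eq s (r n) \<in> T \<and>
        (\<forall>i<n. inst2 \<phi> (r (Suc i)) (r i) \<in> T)"

text \<open>A Lindenbaum construction: stage \<open>n\<close> treats the \<open>n\<close>-th
  well-formed formula, and \<open>T\<close> collects the left sides. Every well-formed formula is
  eventually placed, so one outside \<open>T\<close> is on the right of some stage.\<close>

lemma ex_maximal_theory:
  assumes "countable_signature L" "wf_sequent L (\<Gamma> \<turnstile> \<Delta>)" "\<not> provable L (\<Gamma> \<turnstile> \<Delta>)"
  shows "\<exists>T. maximal_theory L T \<and> \<Gamma> \<subseteq> T \<and> \<Delta> \<inter> T = {}"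
proof -
  let ?W = "{\<phi>. wf_fm L \<phi>}"
  let ?\<chi> = "from_nat_into ?W"
  \<comment> \<open>The enumeration needs a nonempty set; an equation between variables is
    well-formed in every signature.\<close>
  have "Eq (Var 0) (Var 0) \<in> ?W" by simp
  then have "?W \<noteq> {}" by blast
  then have range: "range ?\<chi> = ?W"
    by (rule range_from_nat_into) (rule countable_wf_fm[OF assms(1)])
  let ?P = "\<lambda>n S. wf_sequent L S \<and> \<not> provable L S \<and> \<Gamma> \<subseteq> ante S \<and> \<Delta> \<subseteq> succ S"
  let ?Q = "\<lambda>n S S'. ante S \<subseteq> ante S' \<and> succ S \<subseteq> succ S' \<and> henkin_step L (?\<chi> n) S'"
  have "\<exists>S. \<forall>n. ?P n (S n) \<and> ?Q n (S n) (S (Suc n))"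
  proof (rule dependent_nat_choice)
    show "\<exists>S. ?P 0 S" using assms by (intro exI[of _ "\<Gamma> \<turnstile> \<Delta>"]) simp
  next
    fix S n assume S: "?P n S"
    have "wf_fm L (?\<chi> n)" using range by blast
    then obtain S' where "wf_sequent L S'" "\<not> provable L S'" "ante S \<subseteq> ante S'"
      "succ S \<subseteq> succ S'" "henkin_step L (?\<chi> n) S'"
      using henkin_extend[of L "ante S" "succ S" "?\<chi> n"] S by auto
    then show "\<exists>S'. ?P (Suc n) S' \<and> ?Q n S S'"
      using S by (intro exI[of _ S']) auto
  qed
  then obtain S where S_all: "\<forall>n. ?P n (S n) \<and> ?Q n (S n) (S (Suc n))" ..
  have S: "?P n (S n)" "?Q n (S n) (S (Suc n))" for n
    using spec[OF S_all, of n] by simp_all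
  have mono_ante: "mono (\<lambda>n. ante (S n))" and mono_succ: "mono (\<lambda>n. succ (S n))"
    using S(2) by (auto simp: mono_iff_le_Suc)
  define T where "T = (\<Union>n. ante (S n))"
  \<comment> \<open>A provable sequent is finite, so if it were contained in the limit it would be
    contained in a single stage, which weakening would make provable.\<close>
  have sep: "provable L (A \<turnstile> B) \<Longrightarrow> A \<subseteq> T \<Longrightarrow> \<not> B \<subseteq> (\<Union>n. succ (S n))" for A B
  proof
    assume AB: "provable L (A \<turnstile> B)" "A \<subseteq> T" "B \<subseteq> (\<Union>n. succ (S n))"
    have "finite A" "finite B" using provable_wf[OF AB(1)] by (simp_all add: wf_sequent_def)
    then obtain m n where "A \<subseteq> ante (S m)" "B \<subseteq> succ (S n)"
      using finite_subset_UN_mono mono_ante mono_succ AB(2,3) unfolding T_def by metis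
    moreover have "ante (S m) \<subseteq> ante (S (max m n))" "succ (S n) \<subseteq> succ (S (max m n))"
      using monoD[OF mono_ante, of m "max m n"] monoD[OF mono_succ, of n "max m n"] by simp_all
    ultimately have "A \<subseteq> ante (S (max m n))" "B \<subseteq> succ (S (max m n))" by blast+
    then show False
      using provable_weaken[OF AB(1), of "ante (S (max m n))" "succ (S (max m n))"]
        S(1)[of "max m n"] by simp
  qed
  have disjoint: "\<phi> \<notin> T" if "\<phi> \<in> succ (S n)" for \<phi> n
  proof
    assume "\<phi> \<in> T"
    moreover have "wf_fm L \<phi>" using that S(1)[of n] by (auto simp: wf_sequent_def)
    ultimately show False
      using sep[of "{\<phi>}" "{\<phi>}"] that provable_ax[of \<phi> "{\<phi>}" "{\<phi>}" L]
      by (auto simp: wf_sequent_def)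
  qed
  have step: "\<exists>n. henkin_step L \<phi> (S n)" if "wf_fm L \<phi>" for \<phi>
    using that range S(2) by (metis mem_Collect_eq rangeE)
  have in_succ: "\<phi> \<in> succ (S n)" if "henkin_step L \<phi> (S n)" "\<phi> \<notin> T" for \<phi> n
    using that by (auto simp: henkin_step_def T_def)
  have in_ante: "\<phi> \<in> ante (S n)" if "henkin_step L \<phi> (S n)" "\<phi> \<in> T" for \<phi> n
    using that disjoint by (auto simp: henkin_step_def)
  have "maximal_theory L T"
  proof
    fix A B assume AB: "provable L (A \<turnstile> B)" "A \<subseteq> T"
    then obtain \<phi> where "\<phi> \<in> B" "\<phi> \<notin> (\<Union>n. succ (S n))" using sep by blast
    moreover have "wf_fm L \<phi>"
      using provable_wf[OF AB(1)] \<open>\<phi> \<in> B\<close> by (simp add: wf_sequent_def)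
    then obtain m where "henkin_step L \<phi> (S m)" using step by metis
    ultimately show "B \<inter> T \<noteq> {}" using in_succ[of \<phi> m] by auto
  next
    fix \<phi> assume "wf_fm L (Exists \<phi>)" "Exists \<phi> \<in> T"
    moreover from step[OF this(1)] obtain m where m: "henkin_step L (Exists \<phi>) (S m)" ..
    ultimately have "Exists \<phi> \<in> ante (S m)" using in_ante by simp
    then have "\<exists>z. inst \<phi> (Var z) \<in> ante (S m)" using m by (simp add: henkin_step_def)
    then show "\<exists>z. inst \<phi> (Var z) \<in> T" by (auto simp: T_def)
  next
    fix \<phi> assume "wf_fm L (Forall \<phi>)" "Forall \<phi> \<notin> T"
    moreover from step[OF this(1)] obtain m where m: "henkin_step L (Forall \<phi>) (S m)" ..
    ultimately have "Forall \<phi> \<in> succ (S m)" using in_succ by simp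
    then have "\<exists>z. inst \<phi> (Var z) \<in> succ (S m)" using m by (simp add: henkin_step_def)
    then show "\<exists>z. inst \<phi> (Var z) \<notin> T" using disjoint by auto
  next
    fix \<phi> s t assume "wf_fm L (RTC \<phi> s t)" "RTC \<phi> s t \<in> T"
    moreover from step[OF this(1)] obtain m where m: "henkin_step L (RTC \<phi> s t) (S m)" ..
    ultimately have "RTC \<phi> s t \<in> ante (S m)" using in_ante by simp
    then obtain n r where "r 0 = t" "\<forall>i. wf_tm L (r i)" "Eq s (r n) \<in> ante (S m)"
      "\<forall>i<n. inst2 \<phi> (r (Suc i)) (r i) \<in> ante (S m)"
      using m unfolding henkin_step_def by blast
    then show "\<exists>n r. r 0 = t \<and> (\<forall>i. wf_tm L (r i)) \<and> Eq s (r n) \<in> T \<and>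
        (\<forall>i<n. inst2 \<phi> (r (Suc i)) (r i) \<in> T)"
      by (intro exI[of _ n] exI[of _ r]) (auto simp: T_def)
  qed
  moreover have "\<Gamma> \<subseteq> T" "\<Delta> \<inter> T = {}"
    using S(1)[of 0] disjoint unfolding T_def by blast+
  ultimately show ?thesis by blast
qed

section \<open>Membership in a maximal theory behaves like truth\<close>

context maximal_theory
begin

text \<open>The conclusion is a disjunction since the simplifier loops on the corresponding implications.\<close>

lemma closed_rule:
  assumes "infer Plain Ss (A \<turnstile> B)" "wf_sequent L (A \<turnstile> B)"
    and "\<forall>S\<in>set Ss. wf_sequent L S \<and> ante S \<inter> succ S \<noteq> {}"
  shows "\<not> A \<subseteq> T \<or> B \<inter> T \<noteq> {}"
proof -
  have "provable L S" if "S \<in> set Ss" for S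
    using that assms(3) provable_ax[of _ "ante S" "succ S" L] by auto
  then have "provable L (A \<turnstile> B)" using provable_rule[OF assms(1,2)] by blast
  then show ?thesis using closed by blast
qed

text \<open>Here and for the other connectives the contexts are chosen so that each premise has a
  formula on both sides and is hence an axiom up to weakening.\<close>

lemma Neg_iff: "wf_fm L \<phi> \<Longrightarrow> Neg \<phi> \<in> T \<longleftrightarrow> \<phi> \<notin> T"
  using closed_rule[OF infer.NegL[where \<phi> = \<phi> and \<Gamma> = "{\<phi>}" and \<Delta> = "{}"]]
    closed_rule[OF infer.NegR[where \<phi> = \<phi> and \<Gamma> = "{}" and \<Delta> = "{\<phi>}"]]
  by (auto simp: wf_sequent_def)

lemma Conj_iff:
  "wf_fm L \<phi> \<Longrightarrow> wf_fm L \<psi> \<Longrightarrow> Conj \<phi> \<psi> \<in> T \<longleftrightarrow> \<phi> \<in> T \<and> \<psi> \<in> T"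
  using closed_rule[OF infer.ConjL[where \<phi> = \<phi> and \<psi> = \<psi> and \<Gamma> = "{}" and \<Delta> = "{\<phi>}"]]
    closed_rule[OF infer.ConjL[where \<phi> = \<phi> and \<psi> = \<psi> and \<Gamma> = "{}" and \<Delta> = "{\<psi>}"]]
    closed_rule[OF infer.ConjR[where \<phi> = \<phi> and \<psi> = \<psi> and \<Gamma> = "{\<phi>, \<psi>}" and \<Delta> = "{}"]]
  by (auto simp: wf_sequent_def)

lemma Disj_iff:
  "wf_fm L \<phi> \<Longrightarrow> wf_fm L \<psi> \<Longrightarrow> Disj \<phi> \<psi> \<in> T \<longleftrightarrow> \<phi> \<in> T \<or> \<psi> \<in> T"
  using closed_rule[OF infer.DisjL[where \<phi> = \<phi> and \<psi> = \<psi> and \<Gamma> = "{}" and \<Delta> = "{\<phi>, \<psi>}"]]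
    closed_rule[OF infer.DisjR[where \<phi> = \<phi> and \<psi> = \<psi> and \<Gamma> = "{\<phi>}" and \<Delta> = "{}"]]
    closed_rule[OF infer.DisjR[where \<phi> = \<phi> and \<psi> = \<psi> and \<Gamma> = "{\<psi>}" and \<Delta> = "{}"]]
  by (auto simp: wf_sequent_def)

lemma Imp_iff:
  "wf_fm L \<phi> \<Longrightarrow> wf_fm L \<psi> \<Longrightarrow> Imp \<phi> \<psi> \<in> T \<longleftrightarrow> (\<phi> \<in> T \<longrightarrow> \<psi> \<in> T)"
  using closed_rule[OF infer.ImpL[where \<phi> = \<phi> and \<psi> = \<psi> and \<Gamma> = "{\<phi>}" and \<Delta> = "{\<psi>}"]]
    closed_rule[OF infer.ImpR[where \<phi> = \<phi> and \<psi> = \<psi> and \<Gamma> = "{}" and \<Delta> = "{\<phi>}"]]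
    closed_rule[OF infer.ImpR[where \<phi> = \<phi> and \<psi> = \<psi> and \<Gamma> = "{\<psi>}" and \<Delta> = "{}"]]
  by (auto simp: wf_sequent_def)

lemma Forall_iff:
  assumes "wf_fm L \<phi>"
  shows "Forall \<phi> \<in> T \<longleftrightarrow> (\<forall>t. wf_tm L t \<longrightarrow> inst \<phi> t \<in> T)"
proof
  assume "Forall \<phi> \<in> T"
  then show "\<forall>t. wf_tm L t \<longrightarrow> inst \<phi> t \<in> T"
    using closed_rule[OF infer.ForallL[where \<phi> = \<phi> and \<Gamma> = "{}" and \<Delta> = "{inst \<phi> t}" for t]]
      assms
    by (auto simp: wf_sequent_def wf_inst)
next
  assume *: "\<forall>t. wf_tm L t \<longrightarrow> inst \<phi> t \<in> T"
  have "inst \<phi> (Var z) \<in> T" for z using * by simp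
  then show "Forall \<phi> \<in> T" using Forall_witness[of \<phi>] assms by auto
qed

lemma Exists_iff:
  assumes "wf_fm L \<phi>"
  shows "Exists \<phi> \<in> T \<longleftrightarrow> (\<exists>t. wf_tm L t \<and> inst \<phi> t \<in> T)"
proof
  assume "\<exists>t. wf_tm L t \<and> inst \<phi> t \<in> T"
  then obtain t where "wf_tm L t" "inst \<phi> t \<in> T" by blast
  then show "Exists \<phi> \<in> T"
    using closed_rule[OF infer.ExistsR[where \<phi> = \<phi> and \<Delta> = "{}" and \<Gamma> = "{inst \<phi> t}"
        and t = t]] assms
    by (auto simp: wf_sequent_def wf_inst)
next
  assume "Exists \<phi> \<in> T"
  then obtain z where "inst \<phi> (Var z) \<in> T" using Exists_witness assms by auto
  then show "\<exists>t. wf_tm L t \<and> inst \<phi> t \<in> T" by (intro exI[of _ "Var z"]) simp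
qed

lemma RTC_refl: "wf_fm L \<phi> \<Longrightarrow> wf_tm L s \<Longrightarrow> RTC \<phi> s s \<in> T"
  using closed_rule[OF infer.Refl[where \<phi> = \<phi> and s = s and \<Gamma> = "{}" and \<Delta> = "{}"]]
  by (auto simp: wf_sequent_def)

lemma RTC_trans:
  assumes "wf_fm L \<phi>" "wf_tm L s" "wf_tm L r" "wf_tm L t" "RTC \<phi> s r \<in> T" "inst2 \<phi> r t \<in> T"
  shows "RTC \<phi> s t \<in> T"
  using closed_rule[OF infer.Trans[where \<phi> = \<phi> and s = s and r = r and t = t
        and \<Gamma> = "{RTC \<phi> s r, inst2 \<phi> r t}" and \<Delta> = "{}"]] assms
  by (auto simp: wf_sequent_def wf_inst2)

lemma Eq_refl: "wf_tm L t \<Longrightarrow> Eq t t \<in> T"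
  using closed_rule[OF infer.EqR[where t = t]] by (auto simp: wf_sequent_def)

text \<open>Leibniz's law with \<open>x\<close> marking the places to rewrite. The equality and
  congruence facts that follow use it with a fresh \<open>x\<close>.\<close>

lemma Eq_rewrite:
  assumes "wf_fm L \<phi>" "wf_tm L s" "wf_tm L t" "Eq s t \<in> T" "subst (Var(x := s)) \<phi> \<in> T"
  shows "subst (Var(x := t)) \<phi> \<in> T"
  using closed_rule[OF infer.EqL1[where \<phi> = \<phi> and s = s and t = t and x = x
        and \<Gamma> = "{subst (Var(x := s)) \<phi>}" and \<Delta> = "{}"]] assms
  by (auto simp: wf_sequent_def wf_subst)

text \<open>Rewrites only the left side of \<open>s = s\<close>, where the fresh \<open>x\<close>
  marks the place.\<close>

lemma Eq_sym:
  assumes "wf_tm L s" "wf_tm L t" "Eq s t \<in> T"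
  shows "Eq t s \<in> T"
proof -
  obtain x where x: "x \<notin> fv_tm s" using ex_fresh[OF finite_fv_tm] ..
  show ?thesis
    using Eq_rewrite[of "Eq (Var x) s" s t x] Eq_refl[of s] assms x by simp
qed

lemma Eq_trans:
  assumes "wf_tm L s" "wf_tm L t" "wf_tm L u" "Eq s t \<in> T" "Eq t u \<in> T"
  shows "Eq s u \<in> T"
proof -
  obtain x where x: "x \<notin> fv_tm s" using ex_fresh[OF finite_fv_tm] ..
  show ?thesis
    using Eq_rewrite[of "Eq s (Var x)" t u x] assms x by simp
qed

text \<open>Serves the zero-step clause of \<open>RTC\<close>: reflexivity at \<open>s\<close> is
  transported to any term equal to \<open>s\<close>.\<close>

lemma RTC_rewrite:
  assumes "wf_fm L \<phi>" "wf_tm L s" "wf_tm L t" "wf_tm L u" "Eq t u \<in> T" "RTC \<phi> s t \<in> T"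
  shows "RTC \<phi> s u \<in> T"
proof -
  \<comment> \<open>Freshness for \<open>RTC \<phi> s s\<close> covers the body and the left term at
    once; the right term is where the mark goes.\<close>
  obtain x where x: "x \<notin> fv (RTC \<phi> s s)" using ex_fresh[OF finite_fv] ..
  have "subst (Var(x := r)) (RTC \<phi> s (Var x)) = RTC \<phi> s r" for r
    using subst_fresh[OF x, of r] by simp
  then show ?thesis
    using Eq_rewrite[of "RTC \<phi> s (Var x)" t u x] assms by simp
qed

text \<open>Arguments are replaced one at a time from the left; the prefix \<open>us\<close> holds
  those already replaced and therefore varies in the induction.\<close>

lemma Pred_congruence:
  assumes "list_all2 (\<lambda>s t. wf_tm L s \<and> wf_tm L t \<and> Eq s t \<in> T) ss ts"
    and "wf_fm L (Pred p (us @ ss))" "Pred p (us @ ss) \<in> T"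
  shows "Pred p (us @ ts) \<in> T"
  using assms
proof (induction arbitrary: us)
  case (Cons s ss t ts)
  obtain x where x: "x \<notin> fv (Pred p (us @ ss) :: ('f, 'p) fm)" using ex_fresh[OF finite_fv] ..
  have "subst (Var(x := r)) (Pred p (us @ Var x # ss)) = Pred p (us @ r # ss)" for r
    using x by simp
  then have "Pred p ((us @ [t]) @ ss) \<in> T"
    using Eq_rewrite[of "Pred p (us @ Var x # ss)" s t x] Cons.hyps Cons.prems by simp
  then have "Pred p ((us @ [t]) @ ts) \<in> T"
    using Cons.IH[of "us @ [t]"] Cons.hyps Cons.prems by simp
  then show ?case by simp
qed simp

text \<open>Keeping the left side \<open>u\<close> fixed lets all rewriting happen on the right, so
  that reflexivity is a suitable starting point.\<close>

lemma Fn_congruence: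
  assumes "list_all2 (\<lambda>s t. wf_tm L s \<and> wf_tm L t \<and> Eq s t \<in> T) ss ts"
    and "wf_tm L (Fn f (us @ ss))" "wf_tm L u" "Eq u (Fn f (us @ ss)) \<in> T"
  shows "Eq u (Fn f (us @ ts)) \<in> T"
  using assms
proof (induction arbitrary: us)
  case (Cons s ss t ts)
  obtain x where x: "x \<notin> fv (Eq u (Fn f (us @ ss)) :: ('f, 'p) fm)"
    using ex_fresh[OF finite_fv] ..
  have "subst (Var(x := r)) (Eq u (Fn f (us @ Var x # ss))) = Eq u (Fn f (us @ r # ss))" for r
    using x by simp
  then have "Eq u (Fn f ((us @ [t]) @ ss)) \<in> T"
    using Eq_rewrite[of "Eq u (Fn f (us @ Var x # ss))" s t x] Cons.hyps Cons.prems by simp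
  then have "Eq u (Fn f ((us @ [t]) @ ts)) \<in> T"
    using Cons.IH[of "us @ [t]"] Cons.hyps Cons.prems by simp
  then show ?case by simp
qed simp

end

section \<open>The term model\<close>

text \<open>The injection \<open>e\<close> is all that is required of the type \<open>'u\<close>
  that holds the model.\<close>

locale term_model = maximal_theory L T
  for L :: "('f, 'p) signature" and T :: "('f, 'p) fm set" +
  fixes e :: "'f tm \<Rightarrow> 'u"
  assumes inj_e: "inj_on e {t. wf_tm L t}"
begin

text \<open>A class is coded by one chosen member. Provably equal terms give equivalent choice
  predicates, hence the same choice, and no quotient type has to be formed.\<close>

definition cls :: "'f tm \<Rightarrow> 'u" where
  "cls t = e (SOME s. wf_tm L s \<and> Eq s t \<in> T)"

definition rep :: "'u \<Rightarrow> 'f tm" where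
  "rep u = (SOME t. wf_tm L t \<and> cls t = u)"

text \<open>Symbols are interpreted through representatives; independence of that choice is
  established afterwards from the congruence lemmas.\<close>

definition model :: "('f, 'p, 'u) struct" where
  "model = \<lparr>domain = cls ` {t. wf_tm L t}, fun_interp = \<lambda>f us. cls (Fn f (map rep us)),
     pred_interp = \<lambda>p us. Pred p (map rep us) \<in> T\<rparr>"

lemma model_simps:
  "domain model = cls ` {t. wf_tm L t}"
  "fun_interp model f us = cls (Fn f (map rep us))"
  "pred_interp model p us \<longleftrightarrow> Pred p (map rep us) \<in> T"
  by (simp_all add: model_def)

lemma cls_eq_iff:
  assumes "wf_tm L s" "wf_tm L t"
  shows "cls s = cls t \<longleftrightarrow> Eq s t \<in> T"
proof -
  define c where "c t = (SOME s. wf_tm L s \<and> Eq s t \<in> T)" for t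
  have c: "wf_tm L (c t) \<and> Eq (c t) t \<in> T" if "wf_tm L t" for t
    unfolding c_def by (rule someI[of _ t]) (use that Eq_refl in simp)
  have "cls s = cls t \<longleftrightarrow> c s = c t"
    using inj_onD[OF inj_e] c assms by (auto simp: cls_def c_def)
  also have "\<dots> \<longleftrightarrow> Eq s t \<in> T"
  proof
    assume "c s = c t"
    then show "Eq s t \<in> T"
      using c[of s] c[of t] assms Eq_sym Eq_trans by metis
  next
    assume "Eq s t \<in> T"
    \<comment> \<open>Symmetry and transitivity make the two choice predicates coincide, so
      \<open>SOME\<close> selects the same term.\<close>
    then have "wf_tm L u \<and> Eq u s \<in> T \<longleftrightarrow> wf_tm L u \<and> Eq u t \<in> T" for u
      using assms Eq_sym Eq_trans by metis
    then show "c s = c t" by (simp add: c_def)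
  qed
  finally show ?thesis .
qed

lemma rep: "u \<in> domain model \<Longrightarrow> wf_tm L (rep u) \<and> cls (rep u) = u"
  unfolding rep_def by (rule someI_ex) (auto simp: model_simps)

lemma rep_cls_congruent:
  assumes "\<forall>t\<in>set ts. wf_tm L t"
  shows "list_all2 (\<lambda>s t. wf_tm L s \<and> wf_tm L t \<and> Eq s t \<in> T) (map (\<lambda>t. rep (cls t)) ts) ts"
proof -
  have "wf_tm L (rep (cls t)) \<and> Eq (rep (cls t)) t \<in> T" if "wf_tm L t" for t
    using rep[of "cls t"] cls_eq_iff[of "rep (cls t)" t] that by (auto simp: model_simps)
  then show ?thesis using assms by (simp add: list_all2_conv_all_nth)
qed

lemma is_struct_model: "is_struct L model"
proof -
  have "fun_interp model f us \<in> domain model"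
    if "fun_arity L f = Some (length us)" "set us \<subseteq> domain model" for f us
  proof -
    have "wf_tm L (Fn f (map rep us))" using that rep by auto
    then show ?thesis by (simp add: model_simps del: wf_tm.simps)
  qed
  moreover have "cls (Var 0) \<in> domain model" by (simp add: model_simps)
  ultimately show ?thesis unfolding is_struct_def by blast
qed

lemma val_model:
  assumes "wf_tm L t" "\<And>n. wf_tm L (\<sigma> n)"
  shows "val model (\<lambda>n. cls (\<sigma> n)) t = cls (subst_tm \<sigma> t)"
  using assms(1)
proof (induction t)
  case (Fn f ts)
  let ?ts = "map (subst_tm \<sigma>) ts"
  have wf: "\<forall>t\<in>set ?ts. wf_tm L t" "wf_tm L (Fn f ?ts)"
    using Fn.prems assms(2) by (auto intro: wf_subst_tm)
  let ?rs = "map (\<lambda>t. rep (cls t)) ?ts"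
  note cong = rep_cls_congruent[OF wf(1)]
  have wf_rs: "wf_tm L (Fn f ?rs)"
    using wf cong by (auto simp: list_all2_conv_all_nth in_set_conv_nth)
  \<comment> \<open>Starting from reflexivity of \<open>Fn f ?rs\<close>, the arguments on the right
    are exchanged for the original ones.\<close>
  have "Eq (Fn f ?rs) (Fn f ?ts) \<in> T"
    using Fn_congruence[OF cong, of f "[]" "Fn f ?rs"] wf_rs Eq_refl[OF wf_rs] by simp
  then have "cls (Fn f ?rs) = cls (Fn f ?ts)"
    using cls_eq_iff wf_rs wf(2) by blast
  moreover have "map (val model (\<lambda>n. cls (\<sigma> n))) ts = map cls ?ts"
    using Fn by simp
  ultimately show ?case
    by (simp only: val.simps sat.simps subst_tm.simps subst.simps model_simps map_map comp_def)
qed simp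

lemma case_nat_cls: "case_nat (cls t) (\<lambda>n. cls (\<sigma> n)) = (\<lambda>n. cls (case_nat t \<sigma> n))"
  by (rule ext) (simp split: nat.split)

text \<open>The truth lemma. Letting \<open>\<sigma>\<close> vary carries the induction through
  binders: every element of the domain is the class of a term, so extending the assignment amounts
  to extending \<open>\<sigma>\<close>.\<close>

lemma sat_model:
  assumes "wf_fm L \<phi>" "\<And>n. wf_tm L (\<sigma> n)"
  shows "sat model (\<lambda>n. cls (\<sigma> n)) \<phi> \<longleftrightarrow> subst \<sigma> \<phi> \<in> T"
  using assms
proof (induction \<phi> arbitrary: \<sigma>)
  case (Pred p ts)
  let ?ts = "map (subst_tm \<sigma>) ts"
  let ?rs = "map (\<lambda>t. rep (cls t)) ?ts"
  have wf: "\<forall>t\<in>set ?ts. wf_tm L t" "wf_fm L (Pred p ?ts)"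
    using Pred.prems by (auto intro: wf_subst_tm)
  note cong = rep_cls_congruent[OF wf(1)]
  have wf_rs: "wf_fm L (Pred p ?rs)"
    using wf cong by (auto simp: list_all2_conv_all_nth in_set_conv_nth)
  have "list_all2 (\<lambda>s t. wf_tm L s \<and> wf_tm L t \<and> Eq s t \<in> T) ?ts ?rs"
    using cong Eq_sym by (auto simp: list_all2_conv_all_nth)
  then have "Pred p ?rs \<in> T \<longleftrightarrow> Pred p ?ts \<in> T"
    using Pred_congruence[OF cong, of p "[]"] Pred_congruence[of ?ts ?rs p "[]"] wf(2) wf_rs
    by auto
  moreover have "map (val model (\<lambda>n. cls (\<sigma> n))) ts = map cls ?ts"
    using Pred.prems by (simp add: val_model)
  ultimately show ?case
    by (simp only: val.simps sat.simps subst_tm.simps subst.simps model_simps map_map comp_def)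
next
  case (Eq s t)
  then have "wf_tm L (subst_tm \<sigma> s)" "wf_tm L (subst_tm \<sigma> t)"
    by (auto intro: wf_subst_tm)
  then show ?case using Eq.prems by (simp add: val_model cls_eq_iff)
next
  case (Neg \<phi>)
  then show ?case by (simp add: Neg_iff wf_subst)
next
  case (Conj \<phi> \<psi>)
  then show ?case by (simp add: Conj_iff wf_subst)
next
  case (Disj \<phi> \<psi>)
  then show ?case by (simp add: Disj_iff wf_subst)
next
  case (Imp \<phi> \<psi>)
  then show ?case by (simp add: Imp_iff wf_subst)
next
  case (Forall \<phi>)
  have "sat model (case_nat (cls t) (\<lambda>n. cls (\<sigma> n))) \<phi> \<longleftrightarrow>
      inst (subst (lift_subst \<sigma>) \<phi>) t \<in> T" if "wf_tm L t" for t
    unfolding case_nat_cls inst_lift_subst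
    using Forall.prems that by (intro Forall.IH) (auto split: nat.split)
  then show ?case
    using Forall.prems by (simp add: Forall_iff wf_subst wf_lift_subst) (simp add: model_simps)
next
  case (Exists \<phi>)
  have "sat model (case_nat (cls t) (\<lambda>n. cls (\<sigma> n))) \<phi> \<longleftrightarrow>
      inst (subst (lift_subst \<sigma>) \<phi>) t \<in> T" if "wf_tm L t" for t
    unfolding case_nat_cls inst_lift_subst
    using Exists.prems that by (intro Exists.IH) (auto split: nat.split)
  then show ?case
    using Exists.prems by (simp add: Exists_iff wf_subst wf_lift_subst) (auto simp: model_simps)
next
  case (RTC \<phi> s t)
  define \<psi> where "\<psi> = subst (lift_subst (lift_subst \<sigma>)) \<phi>"
  define s' where "s' = subst_tm \<sigma> s"
  define t' where "t' = subst_tm \<sigma> t"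
  have wf: "wf_fm L \<psi>" "wf_tm L s'" "wf_tm L t'"
    using RTC.prems by (simp_all add: \<psi>_def s'_def t'_def wf_subst wf_subst_tm wf_lift_subst)
  have val: "val model (\<lambda>n. cls (\<sigma> n)) s = cls s'" "val model (\<lambda>n. cls (\<sigma> n)) t = cls t'"
    using RTC.prems by (simp_all add: val_model s'_def t'_def)
  have step: "sat model (case_nat (cls a) (case_nat (cls b) (\<lambda>n. cls (\<sigma> n)))) \<phi> \<longleftrightarrow>
      inst2 \<psi> a b \<in> T" if "wf_tm L a" "wf_tm L b" for a b
    unfolding case_nat_cls \<psi>_def inst2_lift_subst
    using RTC.prems that by (intro RTC.IH) (auto split: nat.split)
  have "sat model (\<lambda>n. cls (\<sigma> n)) (RTC \<phi> s t) \<longleftrightarrow> RTC \<psi> s' t' \<in> T"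
  proof
    assume "RTC \<psi> s' t' \<in> T"
    then obtain n r where r: "r 0 = t'" "\<And>i. wf_tm L (r i)" "Eq s' (r n) \<in> T"
      "\<And>i. i < n \<Longrightarrow> inst2 \<psi> (r (Suc i)) (r i) \<in> T"
      using RTC_chain wf by (metis wf_fm.simps(9))
    have s': "cls s' = cls (r n)" using r wf cls_eq_iff by blast
    show "sat model (\<lambda>n. cls (\<sigma> n)) (RTC \<phi> s t)"
    proof (cases "n = 0")
      case True
      then show ?thesis using s' r(1) by (simp add: val)
    next
      case False
      \<comment> \<open>The chain runs back from \<open>t'\<close>, while a semantic path begins at
        \<open>s'\<close>; hence the index \<open>n - i\<close>.\<close>
      have "sat model (case_nat (cls (r (n - i)))
          (case_nat (cls (r (n - Suc i))) (\<lambda>n. cls (\<sigma> n)))) \<phi>" if "i < n" for i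
        using r(4)[of "n - Suc i"] that step[OF r(2) r(2)] by (simp add: Suc_diff_Suc)
      moreover have "cls (r i) \<in> domain model" for i using r(2) by (simp add: model_simps)
      ultimately have "\<exists>a. (\<forall>i\<le>n. a i \<in> domain model) \<and> a 0 = cls s' \<and> a n = cls t' \<and>
          (\<forall>i<n. sat model (case_nat (a i) (case_nat (a (Suc i)) (\<lambda>n. cls (\<sigma> n)))) \<phi>)"
        using s' r(1) by (intro exI[of _ "\<lambda>i. cls (r (n - i))"]) simp
      then show ?thesis using False by (auto simp: val)
    qed
  next
    assume "sat model (\<lambda>n. cls (\<sigma> n)) (RTC \<phi> s t)"
    then consider (eq) "cls s' = cls t'"
      | (path) n a where "n > 0" "\<And>i. i \<le> n \<Longrightarrow> a i \<in> domain model" "a 0 = cls s'" "a n = cls t'"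
        "\<And>i. i < n \<Longrightarrow> sat model (case_nat (a i) (case_nat (a (Suc i)) (\<lambda>n. cls (\<sigma> n)))) \<phi>"
      by (auto simp: val)
    then show "RTC \<psi> s' t' \<in> T"
    proof cases
      case eq
      then show ?thesis
        using RTC_rewrite[of \<psi> s' s' t'] RTC_refl[of \<psi> s'] cls_eq_iff wf by blast
    next
      case path
      \<comment> \<open>The ends are \<open>s'\<close> and \<open>t'\<close> themselves instead of
        representatives of their classes, so the induction ends in exactly
        \<open>RTC \<psi> s' t'\<close>.\<close>
      define b where "b i = (if i = 0 then s' else if i = n then t' else rep (a i))" for i
      have b: "wf_tm L (b i)" "cls (b i) = a i" if "i \<le> n" for i
        using that path wf rep[of "a i"] by (auto simp: b_def)
      have "RTC \<psi> s' (b i) \<in> T" if "i \<le> n" for i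
        using that
      proof (induction i)
        case 0
        then show ?case using RTC_refl wf by (simp add: b_def)
      next
        case (Suc i)
        then have "inst2 \<psi> (b i) (b (Suc i)) \<in> T"
          using step[of "b i" "b (Suc i)"] path(5)[of i] b[of i] b[of "Suc i"] by simp
        then show ?case
          using RTC_trans[of \<psi> s' "b i" "b (Suc i)"] Suc wf b[of i] b[of "Suc i"] by simp
      qed
      from this[of n] show ?thesis using path(1) by (simp add: b_def)
    qed
  qed
  then show ?case by (simp add: \<psi>_def s'_def t'_def)
qed

end

section \<open>Completeness from the countermodel\<close>

theorem theorem3:
  fixes L :: "('f, 'p) signature" and \<Gamma> \<Delta> :: "('f, 'p) fm set"
  assumes "countable_signature L"
    and "infinite (UNIV :: 'u set)"
    and "wf_sequent L (\<Gamma> \<turnstile> \<Delta>)"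
    and "valid TYPE('u) L (\<Gamma> \<turnstile> \<Delta>)"
  shows "provable L (\<Gamma> \<turnstile> \<Delta>)"
proof (rule ccontr)
  assume "\<not> provable L (\<Gamma> \<turnstile> \<Delta>)"
  then obtain T where T: "maximal_theory L T" "\<Gamma> \<subseteq> T" "\<Delta> \<inter> T = {}"
    using ex_maximal_theory assms(1,3) by blast
  \<comment> \<open>An infinite type contains a copy of \<open>nat\<close>, which gives room for the
    countably many well-formed terms.\<close>
  obtain g :: "nat \<Rightarrow> 'u" where "inj g"
    using infinite_countable_subset[OF assms(2)] by blast
  then have "inj_on (g \<circ> to_nat_on {t. wf_tm L t}) {t. wf_tm L t}"
    using countable_wf_tm[OF assms(1)]
    by (intro comp_inj_on inj_on_to_nat_on) (auto intro: inj_on_subset)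
  then interpret term_model L T "g \<circ> to_nat_on {t. wf_tm L t}"
    using T(1) by (intro term_model.intro term_model_axioms.intro)
  have sat: "sat model (\<lambda>n. cls (Var n)) \<phi> \<longleftrightarrow> \<phi> \<in> T" if "\<phi> \<in> \<Gamma> \<union> \<Delta>" for \<phi>
    using sat_model[of \<phi> Var] that assms(3) by (simp add: wf_sequent_def)
  have "range (\<lambda>n. cls (Var n)) \<subseteq> domain model" by (auto simp: model_simps)
  then have "(\<forall>\<phi>\<in>\<Gamma>. sat model (\<lambda>n. cls (Var n)) \<phi>) \<longrightarrow>
      (\<exists>\<psi>\<in>\<Delta>. sat model (\<lambda>n. cls (Var n)) \<psi>)"
    using assms(4) is_struct_model unfolding valid_def by (metis sequent.sel)
  then show False using sat T(2,3) by blast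
qed

end
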